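(* Consider general MAB satisfying Assumption 1 with $K=2$ arms and $q=1/2$. Let $f_0$ be the reward distribution (density) of the arm in $I$ and $f_1$ that of the arm in $S$, possibly with unbounded support, with $\int|f_1-f_0|>0$, and let $\mu>0$ be the difference between the mean of $f_1$ and the mean of $f_0$. Then for any such $f_0,f_1$, any $\mu>0$, and any $T$ satisfying $$T\le\frac{1}{2\cdot\int|f_0-f_1|}+1,$$ we have $$R_L(T)\ge\frac{T\cdot\mu}{4}.$$
   Context: MAB: at each step $t=1,\dots,T$ the player pulls one of $K$ arms and receives the reward $y_t$ of that arm; rewards of arms are independent over time. Pseudo regret: $R'_T=T\max_k\mu_k-\sum_{t=1}^TE[y_t]$, with $\mu_k$ the mean of arm $k$. Assumption 1: There are two types of arms, superior (set $S$) and inferior (set $I$), in proportions $1-q$ and $q$ respectively ($0\le q\le1$), the proportions being known to the adversary. Arms within $S$ are indistinguishable (identically distributed), and so are those within $I$. The first pull has two steps: first the player selects a set with $P(S)=1-q$, $P(I)=q$, and then the reward of an arm from the selected set is received. (The player is not told which set was selected; a strategy decides at each later step $i>1$, as a function of the rewards $y_1,\dots,y_{i-1}$, whether to pull from the same set as the first pull or from the other set. For $K=2$, $q=1/2$ the first arm is chosen uniformly at random.) $R_L(T)=\inf\sup R'_T$, where the infimum is over all strategies and the supremum is over the MAB instances considered (here those with inferior arm $f_0$ and superior arm $f_1$). *)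

theory Defs
  imports "HOL-Probability.Probability"
begin

text \<open>
  The arms of an instance are \<open>0, \<dots>, num_arms M - 1\<close>; \<open>law M k\<close> is the reward distribution of
  arm \<open>k\<close>.
\<close>

record mab =
  num_arms :: nat
  law :: "nat \<Rightarrow> real measure"
  superior :: "nat set"

definition arms :: "mab \<Rightarrow> nat set" where
  "arms M = {..<num_arms M}"

definition inferior :: "mab \<Rightarrow> nat set" where
  "inferior M = arms M - superior M"

definition mean :: "real measure \<Rightarrow> real" where
  "mean D = (\<integral>x. x \<partial>D)"

definition valid_mab :: "mab \<Rightarrow> bool" where
  "valid_mab M \<longleftrightarrow> num_arms M \<ge> 1 \<and>
     (\<forall>k\<in>arms M. prob_space (law M k) \<and> sets (law M k) = sets borel \<and>
        integrable (law M k) (\<lambda>x. x))"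

definition two_types :: "real \<Rightarrow> mab \<Rightarrow> bool" where
  "two_types q M \<longleftrightarrow> 0 \<le> q \<and> q \<le> 1 \<and> superior M \<subseteq> arms M \<and>
     real (card (superior M)) = (1 - q) * real (num_arms M) \<and>
     real (card (inferior M)) = q * real (num_arms M) \<and>
     (\<forall>j\<in>superior M. \<forall>k\<in>superior M. law M j = law M k) \<and>
     (\<forall>j\<in>inferior M. \<forall>k\<in>inferior M. law M j = law M k) \<and>
     (\<forall>j\<in>inferior M. \<forall>k\<in>superior M. mean (law M j) < mean (law M k))"

text \<open>
  A strategy maps the rewards \<open>[y\<^sub>1, \<dots>, y\<^sub>n]\<close> observed so far to \<open>True\<close> (next pull from the same set
  as the first pull) or \<open>False\<close> (next pull from the other set). The first pull does not consult it.
\<close>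

type_synonym strategy = "real list \<Rightarrow> bool"

definition strategies :: "strategy set" where
  "strategies = {\<sigma>. \<forall>n. (\<lambda>h. \<sigma> (map h [0..<n])) \<in>
     measurable (PiM {..<n} (\<lambda>_. borel)) (count_space UNIV)}"

text \<open>
  An outcome is a pair \<open>(b, X)\<close>: \<open>b\<close> is \<open>True\<close> iff the superior set is selected for the first pull,
  and \<open>X (k, t)\<close> is the reward that arm \<open>k\<close> yields if it is pulled at step \<open>t\<close>.
\<close>

definition outcomes :: "real \<Rightarrow> mab \<Rightarrow> (bool \<times> (nat \<times> nat \<Rightarrow> real)) measure" where
  "outcomes q M = measure_pmf (bernoulli_pmf (1 - q)) \<Otimes>\<^sub>M
     PiM (arms M \<times> UNIV) (\<lambda>(k, t). law M k)"

text \<open>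
  The arms of a set are identically distributed and rewards are independent over time, so the law of
  the reward sequence does not depend on which arm of the chosen set is pulled; we take the first.
  (With two arms, one of each type, there is no choice.)
\<close>

definition arm_from :: "mab \<Rightarrow> bool \<Rightarrow> nat" where
  "arm_from M s = (if s then Min (superior M) else Min (inferior M))"

primrec history :: "mab \<Rightarrow> strategy \<Rightarrow> bool \<times> (nat \<times> nat \<Rightarrow> real) \<Rightarrow> nat \<Rightarrow> real list" where
  "history M \<sigma> \<omega> 0 = []"
| "history M \<sigma> \<omega> (Suc n) =
     (let ys = history M \<sigma> \<omega> n;
          s = (if n = 0 \<or> \<sigma> ys then fst \<omega> else \<not> fst \<omega>)
      in ys @ [snd \<omega> (arm_from M s, Suc n)])"

definition reward :: "mab \<Rightarrow> strategy \<Rightarrow> nat \<Rightarrow> bool \<times> (nat \<times> nat \<Rightarrow> real) \<Rightarrow> real" where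
  "reward M \<sigma> t \<omega> = last (history M \<sigma> \<omega> t)"

definition pseudo_regret :: "real \<Rightarrow> mab \<Rightarrow> strategy \<Rightarrow> nat \<Rightarrow> real" where
  "pseudo_regret q M \<sigma> T =
     real T * Max ((\<lambda>k. mean (law M k)) ` arms M) - (\<Sum>t=1..T. \<integral>\<omega>. reward M \<sigma> t \<omega> \<partial>outcomes q M)"

definition R_L :: "real \<Rightarrow> mab set \<Rightarrow> nat \<Rightarrow> ereal" where
  "R_L q \<M> T = (INF \<sigma>\<in>strategies. SUP M\<in>\<M>. ereal (pseudo_regret q M \<sigma> T))"

definition reward_density :: "(real \<Rightarrow> real) \<Rightarrow> bool" where
  "reward_density f \<longleftrightarrow> f \<in> borel_measurable borel \<and> (\<forall>x. 0 \<le> f x) \<and>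
     integrable lborel f \<and> (\<integral>x. f x \<partial>lborel) = 1 \<and> integrable lborel (\<lambda>x. x * f x)"

definition density_instances ::
    "nat \<Rightarrow> real \<Rightarrow> (real \<Rightarrow> real) \<Rightarrow> (real \<Rightarrow> real) \<Rightarrow> mab set" where
  "density_instances K q f0 f1 = {M. valid_mab M \<and> two_types q M \<and> num_arms M = K \<and>
     (\<forall>k\<in>inferior M. law M k = density lborel (\<lambda>x. ennreal (f0 x))) \<and>
     (\<forall>k\<in>superior M. law M k = density lborel (\<lambda>x. ennreal (f1 x)))}"

end

theory Submission
  imports Defs
begin

text \<open>
  A single instance suffices: at every step the inferior arm is pulled with probability at least
  \<open>1/4\<close>. Let \<open>E\<^sub>S\<close> and \<open>E\<^sub>I\<close> be the expectations given that the first pull is from \<open>S\<close> or from \<open>I\<close>.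
  Whatever the strategy does, the next reward has density \<open>f\<^sub>0\<close> or \<open>f\<^sub>1\<close>, and exchanging these
  densities changes the mean of a \<open>[0,1]\<close>-valued function by at most \<open>\<delta> = \<integral>|f\<^sub>0 - f\<^sub>1|\<close>. By induction,
  \<open>|E\<^sub>S \<phi> - E\<^sub>I \<phi>| \<le> n \<delta>\<close> for every \<open>[0,1]\<close>-valued \<open>\<phi>\<close> of the first \<open>n\<close> rewards. Let \<open>\<phi>\<close> indicate
  the decision that pulls from \<open>S\<close> when the first pull was from \<open>S\<close>. The same decision pulls from
  \<open>I\<close> when the first pull was from \<open>I\<close>, so the superior arm is pulled at step \<open>n + 1\<close> with probability
  \<open>(E\<^sub>S \<phi> + 1 - E\<^sub>I \<phi>) / 2 \<le> (1 + n \<delta>) / 2 \<le> 3/4\<close>, as \<open>n \<delta> \<le> (T - 1) \<delta> \<le> 1/2\<close>.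
\<close>

section \<open>Resampling in product measures; integrals against densities\<close>

text \<open>Resampling coordinate \<open>i\<close> of a point of the product space preserves the product measure.\<close>

lemma integral_PiM_component:
  fixes H :: "('i \<Rightarrow> 'a) \<Rightarrow> 'a \<Rightarrow> real"
  assumes M: "\<And>j. j \<in> I \<Longrightarrow> prob_space (M j)" and i: "i \<in> I"
    and int: "integrable (M i \<Otimes>\<^sub>M PiM I M) (\<lambda>(z, X). H X z)"
    and H: "(\<lambda>X. H X (X i)) \<in> borel_measurable (PiM I M)"
    and indep: "\<And>X y z. H (X(i := y)) z = H X z"
  shows "(\<integral>X. H X (X i) \<partial>PiM I M) = (\<integral>X. (\<integral>z. H X z \<partial>M i) \<partial>PiM I M)"
proof -
  interpret Mi: prob_space "M i" using M i by blast
  interpret P: prob_space "PiM I M" using M by (rule prob_space_PiM)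
  interpret pair_sigma_finite "M i" "PiM I M" ..
  \<comment> \<open>As \<open>i\<close> lies in \<open>I\<close>, \<open>insert i I\<close> is
    \<open>I\<close>: the general facts on adding a coordinate then describe overwriting
    one.\<close>
  have upd: "(\<lambda>(z, X). X(i := z)) \<in> measurable (M i \<Otimes>\<^sub>M PiM I M) (PiM I M)"
    using measurable_compose[OF measurable_pair_swap' measurable_add_dim[of i I M]] i
    by (simp add: insert_absorb split_def)
  have "(\<integral>X. H X (X i) \<partial>PiM I M) =
      (\<integral>X. H X (X i) \<partial>distr (M i \<Otimes>\<^sub>M PiM I M) (PiM I M) (\<lambda>(z, X). X(i := z)))"
    using distr_pair_PiM_eq_PiM[of I M i] M i by (simp add: insert_absorb)
  also have "\<dots> = (\<integral>(z, X). H X z \<partial>(M i \<Otimes>\<^sub>M PiM I M))"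
    by (subst integral_distr[OF upd H]) (simp add: split_def indep)
  also have "\<dots> = (\<integral>X. (\<integral>z. H X z \<partial>M i) \<partial>PiM I M)"
    using integral_snd[of "\<lambda>z X. H X z"] int by simp
  finally show ?thesis .
qed

text \<open>Over \<open>lborel\<close> the difference is the integral of
  \<open>(f x - g x) * \<psi> x\<close>, and \<open>\<bar>\<psi> x\<bar> \<le> 1\<close>.\<close>

lemma integral_density_diff_le:
  fixes f g \<psi> :: "real \<Rightarrow> real"
  assumes [measurable]: "f \<in> borel_measurable borel" "g \<in> borel_measurable borel"
      "\<psi> \<in> borel_measurable borel"
    and f: "integrable lborel f" "\<And>x. 0 \<le> f x" and g: "integrable lborel g" "\<And>x. 0 \<le> g x"
    and \<psi>: "\<And>x. \<bar>\<psi> x\<bar> \<le> 1"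
  shows "\<bar>(\<integral>x. \<psi> x \<partial>density lborel f) - (\<integral>x. \<psi> x \<partial>density lborel g)\<bar>
      \<le> (\<integral>x. \<bar>f x - g x\<bar> \<partial>lborel)"
proof -
  have i: "integrable lborel (\<lambda>x. h x * \<psi> x)" if "integrable lborel h" for h :: "real \<Rightarrow> real"
    by (rule Bochner_Integration.integrable_bound[OF that])
      (use that \<psi> in \<open>auto simp: abs_mult mult_left_le\<close>)
  have "(\<integral>x. \<psi> x \<partial>density lborel f) - (\<integral>x. \<psi> x \<partial>density lborel g)
      = (\<integral>x. f x * \<psi> x \<partial>lborel) - (\<integral>x. g x * \<psi> x \<partial>lborel)"
    using f g by (simp add: integral_density)
  also have "\<dots> = (\<integral>x. (f x - g x) * \<psi> x \<partial>lborel)"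
    using i f g by (simp add: left_diff_distrib)
  also have "\<bar>\<dots>\<bar> \<le> (\<integral>x. \<bar>(f x - g x) * \<psi> x\<bar> \<partial>lborel)"
    by (rule integral_abs_bound)
  also have "\<dots> \<le> (\<integral>x. \<bar>f x - g x\<bar> \<partial>lborel)"
    using f g \<psi> by (intro integral_mono integrable_abs i Bochner_Integration.integrable_diff)
      (auto simp: abs_mult mult_left_le)
  finally show ?thesis .
qed

lemma map_restrict_upt: "map (\<lambda>i\<in>{..<n}. f i) [0..<n] = map f [0..<n]"
  by simp

section \<open>The two-armed instance under a fixed strategy\<close>

locale two_arms =
  fixes D :: "bool \<Rightarrow> real measure" and \<sigma> :: strategy
  assumes prob_space_D: "prob_space (D s)"
    and sets_D [simp, measurable_cong]: "sets (D s) = sets borel"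
    and integrable_D: "integrable (D s) (\<lambda>x. x)"
    and strategy: "\<sigma> \<in> strategies"
begin

definition inst :: mab where
  "inst = \<lparr>num_arms = 2, law = (\<lambda>k. D (k = 1)), superior = {1}\<rparr>"

definition laws :: "nat \<times> nat \<Rightarrow> real measure" where
  "laws = (\<lambda>(k, t). D (k = 1))"

definition P :: "(nat \<times> nat \<Rightarrow> real) measure" where
  "P = PiM ({..<2} \<times> UNIV) laws"

text \<open>True means that the pull after the rewards \<open>ys\<close> is from the superior set,
  if the first pull was of type \<open>b\<close>. The empty list stands for the first pull, which
  ignores the strategy.\<close>

definition sel :: "bool \<Rightarrow> real list \<Rightarrow> bool" where
  "sel b ys = (if ys = [] \<or> \<sigma> ys then b else \<not> b)"

definition hist :: "bool \<Rightarrow> nat \<Rightarrow> (nat \<times> nat \<Rightarrow> real) \<Rightarrow> real list" where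
  "hist b n X = history inst \<sigma> (b, X) n"

text \<open>Indices start at 0: this is the reward of step \<open>Suc n\<close>, the first one not
  in \<open>hist b n X\<close>.\<close>

definition rew :: "bool \<Rightarrow> nat \<Rightarrow> (nat \<times> nat \<Rightarrow> real) \<Rightarrow> real" where
  "rew b n X = X (of_bool (sel b (hist b n X)), Suc n)"

lemma sel_False: "sel False ys \<longleftrightarrow> \<not> sel True ys"
  by (simp add: sel_def)

lemma inst_simps [simp]: "num_arms inst = 2" "law inst k = D (k = 1)" "superior inst = {1}"
  by (simp_all add: inst_def)

lemma arms_inst: "arms inst = {..<2}"
  by (simp add: arms_def)

lemma inferior_inst: "inferior inst = {0}"
  by (auto simp: arms_def inferior_def)

lemma arm_from_inst: "arm_from inst s = of_bool s"
  by (simp add: arm_from_def inferior_inst)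

lemma length_hist: "length (hist b n X) = n"
  by (induction n) (auto simp: hist_def Let_def)

lemma hist_0 [simp]: "hist b 0 X = []"
  by (simp add: hist_def)

lemma hist_Suc: "hist b (Suc n) X = hist b n X @ [rew b n X]"
proof -
  have "n = 0 \<longleftrightarrow> hist b n X = []"
    using length_hist[of b n X] by auto
  then show ?thesis
    by (auto simp: hist_def rew_def Let_def arm_from_inst sel_def)
qed

lemma hist_eq_map: "hist b n X = map (\<lambda>i. rew b i X) [0..<n]"
  by (induction n) (auto simp: hist_Suc)

lemma reward_Suc: "reward inst \<sigma> (Suc n) (b, X) = rew b n X"
  using hist_Suc[of b n X] by (simp add: reward_def hist_def del: history.simps)

text \<open>Only table entries of steps \<open>1\<close> to \<open>n\<close> are read. Hence the
  reward of a later step is independent of the history.\<close>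

lemma hist_upd: "n \<le> m \<Longrightarrow> hist b n (X((k, Suc m) := y)) = hist b n X"
  by (induction n) (auto simp: hist_Suc rew_def)

sublocale P: prob_space P
  unfolding P_def by (rule prob_space_PiM) (auto simp: laws_def prob_space_D)

section \<open>Measurability and integrability of rewards\<close>

lemma measurable_sel:
  "(\<lambda>h. sel b (map h [0..<n])) \<in> measurable (PiM {..<n} (\<lambda>_. borel)) (count_space UNIV)"
proof -
  have [measurable]: "Measurable.pred (PiM {..<n} (\<lambda>_. borel)) (\<lambda>h. \<sigma> (map h [0..<n]))"
    using strategy by (simp add: strategies_def)
  show ?thesis unfolding sel_def by (cases "n = 0") auto
qed

lemma measurable_D: "measurable N (D s) = borel_measurable N"
  by (rule measurable_cong_sets) auto

lemma measurable_component: "k < 2 \<Longrightarrow> (\<lambda>X. X (k, t)) \<in> borel_measurable P"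
  using measurable_component_singleton[of "(k, t)" "{..<2} \<times> UNIV" laws]
  by (simp add: P_def laws_def measurable_D)

text \<open>Measurability of the earlier rewards is a hypothesis so that the lemma can serve inside
  the strong induction for \<open>measurable_rew\<close>.\<close>

lemma measurable_hist_compose':
  assumes rew: "\<And>i. i < n \<Longrightarrow> rew b i \<in> borel_measurable P"
    and g: "(\<lambda>h. g (map h [0..<n])) \<in> measurable (PiM {..<n} (\<lambda>_. borel)) N"
  shows "(\<lambda>X. g (hist b n X)) \<in> measurable P N"
proof -
  have "(\<lambda>X. \<lambda>i\<in>{..<n}. rew b i X) \<in> measurable P (PiM {..<n} (\<lambda>_. borel))"
    using rew by (intro measurable_restrict) auto
  from measurable_compose[OF this g] show ?thesis
    by (simp add: hist_eq_map map_restrict_upt)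
qed

lemma measurable_rew [measurable]: "rew b n \<in> borel_measurable P"
proof (induction n rule: less_induct)
  case (less n)
  have [measurable]: "Measurable.pred P (\<lambda>X. sel b (hist b n X))"
    by (rule measurable_hist_compose'[OF less measurable_sel])
  note measurable_component[of 0, measurable] measurable_component[of 1, measurable]
  have "rew b n = (\<lambda>X. if sel b (hist b n X) then X (1, Suc n) else X (0, Suc n))"
    by (auto simp: rew_def fun_eq_iff)
  also have "\<dots> \<in> borel_measurable P"
    by simp
  finally show ?case .
qed

lemmas measurable_hist_compose = measurable_hist_compose'[OF measurable_rew]

lemma integrable_component: "k < 2 \<Longrightarrow> integrable P (\<lambda>X. X (k, t))"
proof -
  assume k: "k < 2"
  have "distr P (D (k = 1)) (\<lambda>X. X (k, t)) = D (k = 1)"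
    using distr_PiM_component[of "{..<2} \<times> UNIV" laws "(k, t)"] k
    by (auto simp: P_def laws_def prob_space_D)
  then have "integrable (distr P (D (k = 1)) (\<lambda>X. X (k, t))) (\<lambda>x. x)"
    using integrable_D by metis
  then show ?thesis
    by (rule integrable_distr[rotated]) (use k in \<open>simp add: measurable_D measurable_component\<close>)
qed

text \<open>An integrable bound that does not depend on the decision, as rewards may be
  unbounded.\<close>

lemma abs_rew_le: "\<bar>rew b n X\<bar> \<le> \<bar>X (0, Suc n)\<bar> + \<bar>X (1, Suc n)\<bar>"
  by (cases "sel b (hist b n X)") (auto simp: rew_def)

lemma integrable_rew: "integrable P (rew b n)"
proof (rule Bochner_Integration.integrable_bound)
  show "integrable P (\<lambda>X. \<bar>X (0, Suc n)\<bar> + \<bar>X (1, Suc n)\<bar>)"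
    by (intro Bochner_Integration.integrable_add integrable_abs integrable_component) auto
qed (use abs_rew_le in auto)

section \<open>Integrating out the next reward\<close>

text \<open>Given the history, the next reward is a fresh draw from the law of the arm that the
  history selects. Linear growth of \<open>\<Phi>\<close> covers both \<open>[0,1]\<close>-valued
  functions and the reward itself.\<close>

lemma expectation_step:
  fixes \<Phi> :: "real list \<Rightarrow> real \<Rightarrow> real"
  assumes meas: "(\<lambda>(h, x). \<Phi> (map h [0..<n]) x)
      \<in> borel_measurable (PiM {..<n} (\<lambda>_. borel) \<Otimes>\<^sub>M borel)"
    and bound: "\<And>l x. \<bar>\<Phi> l x\<bar> \<le> 1 + \<bar>x\<bar>"
  shows "(\<integral>X. \<Phi> (hist b n X) (rew b n X) \<partial>P)
    = (\<integral>X. (\<integral>x. \<Phi> (hist b n X) x \<partial>D (sel b (hist b n X))) \<partial>P)"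
proof -
  let ?G = "\<lambda>s X z. of_bool (sel b (hist b n X) = s) * \<Phi> (hist b n X) z"
  have tup: "(\<lambda>X. \<lambda>i\<in>{..<n}. rew b i X) \<in> measurable P (PiM {..<n} (\<lambda>_. borel))"
    by (intro measurable_restrict) auto
  have \<Phi>m: "(\<lambda>w. \<Phi> (hist b n (u w)) (v w)) \<in> borel_measurable N"
    if u: "u \<in> measurable N P" and v: "v \<in> borel_measurable N" for u v and N :: "'c measure"
    using measurable_compose[OF measurable_Pair[OF measurable_compose[OF u tup] v] meas]
    by (simp add: hist_eq_map map_restrict_upt)
  have sm [measurable]: "Measurable.pred P (\<lambda>X. sel b (hist b n X))"
    by (rule measurable_hist_compose[OF measurable_sel])
  have Gm: "(\<lambda>w. ?G s (u w) (v w)) \<in> borel_measurable N"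
    if [measurable]: "u \<in> measurable N P" "v \<in> borel_measurable N" for u v s and N :: "'c measure"
  proof -
    note \<Phi>m[OF that, measurable]
    show ?thesis by measurable
  qed
  have Gb: "\<bar>?G s X z\<bar> \<le> 1 + \<bar>z\<bar>" for s X z
    using bound[of "hist b n X" z] by (auto simp: abs_mult)
  have integrable_G: "integrable (D s \<Otimes>\<^sub>M P) (\<lambda>(z, X). ?G s X z)" for s
  proof -
    interpret Ds: prob_space "D s" by (rule prob_space_D)
    interpret pair: pair_prob_space "D s" P ..
    have "integrable (D s \<Otimes>\<^sub>M P) (\<lambda>(z, X). 1 + \<bar>z\<bar>)"
    proof (rule pair.Fubini_integrable)
      show "integrable (D s) (\<lambda>x. \<integral>y. norm ((\<lambda>(z, X). 1 + \<bar>z\<bar>) (x, y)) \<partial>P)"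
        using integrable_D by (simp add: P.prob_space)
    qed (auto simp: measurable_split_conv)
    then show ?thesis
    proof (rule Bochner_Integration.integrable_bound)
      show "(\<lambda>(z, X). ?G s X z) \<in> borel_measurable (D s \<Otimes>\<^sub>M P)"
        unfolding split_def by (rule Gm) auto
    qed (use Gb in \<open>auto simp del: abs_mult\<close>)
  qed
  have rest: "(\<integral>X. ?G s X (X (of_bool s, Suc n)) \<partial>P) = (\<integral>X. (\<integral>z. ?G s X z \<partial>D s) \<partial>P)" for s
  proof -
    have "laws (of_bool s, Suc n) = D s"
      by (cases s) (auto simp: laws_def)
    moreover have "(\<lambda>X. ?G s X (X (of_bool s, Suc n))) \<in> borel_measurable P"
      by (rule Gm) (auto intro: measurable_component)
    ultimately show ?thesis
      unfolding P_def
      using integral_PiM_component[of "{..<2} \<times> UNIV" laws "(of_bool s, Suc n)" "?G s"]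
        integrable_G[of s]
      by (auto simp: P_def laws_def prob_space_D hist_upd)
  qed
  have iG: "integrable P (\<lambda>X. ?G s X (X (of_bool s, Suc n)))" for s
  proof (rule Bochner_Integration.integrable_bound)
    show "integrable P (\<lambda>X. 1 + \<bar>X (of_bool s, Suc n)\<bar>)"
      by (intro Bochner_Integration.integrable_add integrable_abs integrable_component) auto
    show "(\<lambda>X. ?G s X (X (of_bool s, Suc n))) \<in> borel_measurable P"
      by (rule Gm) (auto intro: measurable_component)
  qed (use Gb in \<open>auto simp del: abs_mult\<close>)
  have iG': "integrable P (\<lambda>X. \<integral>z. ?G s X z \<partial>D s)" for s
  proof -
    interpret Ds: prob_space "D s" by (rule prob_space_D)
    interpret pair_sigma_finite "D s" P ..
    show ?thesis using integrable_snd[of "\<lambda>z X. ?G s X z"] integrable_G by simp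
  qed
  have "(\<integral>X. \<Phi> (hist b n X) (rew b n X) \<partial>P)
      = (\<integral>X. ?G True X (X (of_bool True, Suc n)) + ?G False X (X (of_bool False, Suc n)) \<partial>P)"
    by (intro Bochner_Integration.integral_cong) (auto simp: rew_def)
  also have "\<dots> = (\<integral>X. (\<integral>z. ?G True X z \<partial>D True) + (\<integral>z. ?G False X z \<partial>D False) \<partial>P)"
    using iG[of True] iG[of False] iG'[of True] iG'[of False] rest[of True] rest[of False]
    by (simp only: Bochner_Integration.integral_add)
  also have "\<dots> = (\<integral>X. (\<integral>x. \<Phi> (hist b n X) x \<partial>D (sel b (hist b n X))) \<partial>P)"
    by (intro Bochner_Integration.integral_cong) auto
  finally show ?thesis .
qed

lemma expectation_hist_diff_le:
  assumes \<delta>: "\<And>\<psi>. \<psi> \<in> borel_measurable borel \<Longrightarrow> (\<And>x. 0 \<le> \<psi> x \<and> \<psi> x \<le> 1) \<Longrightarrow>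
      \<bar>(\<integral>x. \<psi> x \<partial>D True) - (\<integral>x. \<psi> x \<partial>D False)\<bar> \<le> \<delta>"
    and "(\<lambda>h. \<phi> (map h [0..<n])) \<in> borel_measurable (PiM {..<n} (\<lambda>_. borel))"
    and "\<And>l. 0 \<le> \<phi> l \<and> \<phi> l \<le> (1::real)"
  shows "\<bar>(\<integral>X. \<phi> (hist True n X) \<partial>P) - (\<integral>X. \<phi> (hist False n X) \<partial>P)\<bar> \<le> real n * \<delta>"
  using assms(2,3)
proof (induction n arbitrary: \<phi>)
  case 0
  then show ?case by simp
next
  case (Suc n)
  have "{..<Suc n} = insert n {..<n}" by auto
  then have upd: "(\<lambda>(h, x). h(n := x)) \<in> measurable (PiM {..<n} (\<lambda>_. borel) \<Otimes>\<^sub>M borel)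
      (PiM {..<Suc n} (\<lambda>_. borel :: real measure))"
    using measurable_add_dim[of n "{..<n}" "\<lambda>_. borel :: real measure"] by simp
  have map_upd: "map (h(n := x)) [0..<Suc n] = map h [0..<n] @ [x]" for h and x :: real
    by simp
  have \<Phi>: "(\<lambda>(h, x). \<phi> (map h [0..<n] @ [x]))
      \<in> borel_measurable (PiM {..<n} (\<lambda>_. borel) \<Otimes>\<^sub>M borel)"
    using measurable_compose[OF upd Suc.prems(1)] unfolding split_def map_upd .
  define J where "J = (\<lambda>s l. \<integral>x. \<phi> (l @ [x]) \<partial>D s)"
  define g where "g = (\<lambda>b l. J (sel b l) l)"
  have \<phi>m: "(\<lambda>x. \<phi> (l @ [x])) \<in> borel_measurable borel" if "length l = n" for l
  proof -
    have "restrict (nth l) {..<n} \<in> space (PiM {..<n} (\<lambda>_. borel :: real measure))"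
      by (auto simp: space_PiM)
    from measurable_Pair2[OF \<Phi> this]
    have "(\<lambda>x. \<phi> (map (restrict (nth l) {..<n}) [0..<n] @ [x])) \<in> borel_measurable borel"
      by simp
    moreover have "map (restrict (nth l) {..<n}) [0..<n] = l"
      using that by (auto intro!: nth_equalityI)
    ultimately show ?thesis by simp
  qed
  have Jm [measurable]: "(\<lambda>h. J s (map h [0..<n])) \<in> borel_measurable (PiM {..<n} (\<lambda>_. borel))" for s
  proof -
    interpret Ds: prob_space "D s" by (rule prob_space_D)
    note \<Phi>[measurable]
    show ?thesis unfolding J_def
      by (rule Ds.borel_measurable_lebesgue_integral) measurable
  qed
  have gm: "(\<lambda>h. g b (map h [0..<n])) \<in> borel_measurable (PiM {..<n} (\<lambda>_. borel))" for b
  proof -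
    note measurable_sel[of b n, measurable]
    have "(\<lambda>h. g b (map h [0..<n]))
        = (\<lambda>h. if sel b (map h [0..<n]) then J True (map h [0..<n]) else J False (map h [0..<n]))"
      by (auto simp: g_def fun_eq_iff)
    also have "\<dots> \<in> borel_measurable (PiM {..<n} (\<lambda>_. borel))"
      by measurable
    finally show ?thesis .
  qed
  have J01: "0 \<le> J s l \<and> J s l \<le> 1" for s l
  proof -
    interpret Ds: prob_space "D s" by (rule prob_space_D)
    have "J s l \<le> 1" if "integrable (D s) (\<lambda>x. \<phi> (l @ [x]))"
      unfolding J_def using Ds.integral_le_const[OF that] Suc.prems(2) by simp
    then show ?thesis
      by (cases "integrable (D s) (\<lambda>x. \<phi> (l @ [x]))")
        (auto simp: J_def not_integrable_integral_eq Suc.prems(2) intro!: integral_nonneg_AE)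
  qed
  then have g01: "0 \<le> g b l \<and> g b l \<le> 1" for b l
    by (simp add: g_def)
  have step: "(\<integral>X. \<phi> (hist b (Suc n) X) \<partial>P) = (\<integral>X. g b (hist b n X) \<partial>P)" for b
  proof -
    have "\<bar>\<phi> l\<bar> \<le> 1 + \<bar>x\<bar>" for l and x :: real
      using Suc.prems(2)[of l] by linarith
    with expectation_step[of "\<lambda>l x. \<phi> (l @ [x])" n b] \<Phi> show ?thesis
      by (simp add: hist_Suc g_def J_def)
  qed
  have int: "integrable P (\<lambda>X. g b (hist b' n X))" for b b'
    using measurable_hist_compose[OF gm] g01
    by (intro P.integrable_const_bound[of _ 1]) (auto simp: abs_le_iff intro: order_trans[of _ 0])
  have diff: "\<bar>g True l - g False l\<bar> \<le> \<delta>" if "length l = n" for l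
    using \<delta>[OF \<phi>m[OF that] Suc.prems(2)]
    by (cases "sel True l") (auto simp: g_def J_def sel_False)
  have "\<bar>(\<integral>X. g True (hist True n X) \<partial>P) - (\<integral>X. g False (hist True n X) \<partial>P)\<bar>
      = \<bar>\<integral>X. g True (hist True n X) - g False (hist True n X) \<partial>P\<bar>"
    using int by simp
  also have "\<dots> \<le> (\<integral>X. \<bar>g True (hist True n X) - g False (hist True n X)\<bar> \<partial>P)"
    by (rule integral_abs_bound)
  also have "\<dots> \<le> \<delta>"
    using int by (intro P.integral_le_const integrable_abs Bochner_Integration.integrable_diff)
      (auto simp: diff length_hist)
  finally show ?case
    using Suc.IH[OF gm[of False] g01] unfolding step by (simp add: algebra_simps)
qed

lemma expectation_rew:
  "(\<integral>X. rew b n X \<partial>P) = mean (D False)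
     + (mean (D True) - mean (D False)) * (\<integral>X. of_bool (sel b (hist b n X)) \<partial>P)"
proof -
  have [measurable]: "Measurable.pred P (\<lambda>X. sel b (hist b n X))"
    by (rule measurable_hist_compose[OF measurable_sel])
  have int: "integrable P (\<lambda>X. of_bool (sel b (hist b n X)) :: real)"
    by (rule P.integrable_const_bound[of _ 1]) auto
  have "(\<integral>X. rew b n X \<partial>P) = (\<integral>X. mean (D (sel b (hist b n X))) \<partial>P)"
    using expectation_step[of "\<lambda>_ x. x" n b] by (simp add: mean_def)
  also have "\<dots> = (\<integral>X. mean (D False)
      + (mean (D True) - mean (D False)) * of_bool (sel b (hist b n X)) \<partial>P)"
    by (intro Bochner_Integration.integral_cong) (auto intro: arg_cong[of _ _ "\<lambda>s. mean (D s)"])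
  also have "\<dots> = mean (D False)
      + (mean (D True) - mean (D False)) * (\<integral>X. of_bool (sel b (hist b n X)) \<partial>P)"
    using int by (simp add: P.prob_space)
  finally show ?thesis .
qed

lemma expectation_reward:
  "(\<integral>\<omega>. reward inst \<sigma> (Suc n) \<omega> \<partial>outcomes (1/2) inst)
    = ((\<integral>X. rew True n X \<partial>P) + (\<integral>X. rew False n X \<partial>P)) / 2"
proof -
  let ?B = "measure_pmf (bernoulli_pmf (1/2))"
  interpret B: pair_prob_space ?B P ..
  have out: "outcomes (1/2) inst = ?B \<Otimes>\<^sub>M P"
    by (simp add: outcomes_def P_def laws_def arms_inst)
  have eq: "reward inst \<sigma> (Suc n) = (\<lambda>(b, X). rew b n X)"
    by (auto simp: fun_eq_iff reward_Suc)
  have "(\<lambda>(b, X). rew b n X) \<in> borel_measurable (count_space UNIV \<Otimes>\<^sub>M P)"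
    by (rule measurable_pair_measure_countable1) auto
  then have meas: "(\<lambda>(b, X). rew b n X) \<in> borel_measurable (?B \<Otimes>\<^sub>M P)"
    by (simp cong: measurable_cong_sets sets_pair_measure_cong)
  have "integrable (?B \<Otimes>\<^sub>M P) (\<lambda>(b, X). rew b n X)"
    using meas
  proof (rule B.Fubini_integrable)
    show "integrable ?B (\<lambda>b. \<integral>X. norm ((\<lambda>(b, X). rew b n X) (b, X)) \<partial>P)"
      by (rule integrable_measure_pmf_finite) simp
  qed (auto simp: integrable_rew)
  then have "(\<integral>\<omega>. (\<lambda>(b, X). rew b n X) \<omega> \<partial>(?B \<Otimes>\<^sub>M P)) = (\<integral>b. (\<integral>X. rew b n X \<partial>P) \<partial>?B)"
    using B.integral_fst[of "\<lambda>b X. rew b n X"] by simp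
  then show ?thesis
    by (simp add: out eq field_simps)
qed

lemma pseudo_regret_ge:
  assumes \<mu>: "mean (D False) < mean (D True)"
    and \<delta>: "\<And>\<psi>. \<psi> \<in> borel_measurable borel \<Longrightarrow> (\<And>x. 0 \<le> \<psi> x \<and> \<psi> x \<le> 1) \<Longrightarrow>
      \<bar>(\<integral>x. \<psi> x \<partial>D True) - (\<integral>x. \<psi> x \<partial>D False)\<bar> \<le> \<delta>"
    and T: "(real T - 1) * \<delta> \<le> 1/2"
  shows "real T * (mean (D True) - mean (D False)) / 4 \<le> pseudo_regret (1/2) inst \<sigma> T"
proof -
  let ?m0 = "mean (D False)" and ?m1 = "mean (D True)"
  have step: "(\<integral>\<omega>. reward inst \<sigma> t \<omega> \<partial>outcomes (1/2) inst) \<le> ?m1 - (?m1 - ?m0) / 4"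
    if t: "t \<in> {1..T}" for t
  proof -
    obtain n where n: "t = Suc n" "real n \<le> real T - 1"
      using t by (cases t) auto
    let ?p = "\<lambda>b b'. \<integral>X. of_bool (sel b (hist b' n X)) \<partial>P :: real"
    have [measurable]: "Measurable.pred P (\<lambda>X. sel b (hist b' n X))" for b b'
      by (rule measurable_hist_compose[OF measurable_sel])
    have int: "integrable P (\<lambda>X. of_bool (sel b (hist b' n X)) :: real)" for b b'
      by (rule P.integrable_const_bound[of _ 1]) auto
    have pF: "?p False False = 1 - ?p True False"
    proof -
      have "?p False False = (\<integral>X. 1 - of_bool (sel True (hist False n X)) \<partial>P)"
        by (simp add: sel_False of_bool_not_iff)
      with int show ?thesis by (simp add: P.prob_space)
    qed
    have "0 \<le> \<delta>"
      using \<delta>[of "\<lambda>_. 0"] by simp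
    then have "real n * \<delta> \<le> 1/2"
      using T mult_right_mono[OF n(2), of \<delta>] by simp
    moreover have "\<bar>?p True True - ?p True False\<bar> \<le> real n * \<delta>"
      using expectation_hist_diff_le[of \<delta> "\<lambda>l. of_bool (sel True l)" n] \<delta> measurable_sel[of True n]
      by simp
    ultimately have "?p True True + ?p False False \<le> 3/2"
      unfolding pF by linarith
    then have "(?m1 - ?m0) * (?p True True + ?p False False) \<le> (?m1 - ?m0) * (3/2)"
      using \<mu> by (intro mult_left_mono) auto
    moreover have "(m + d * p + (m + d * q)) / 2 \<le> (m + d) - d / 4"
      if "d * (p + q) \<le> d * (3/2)" for m d p q :: real
      using that by (simp add: distrib_left)
    ultimately show ?thesis
      unfolding n expectation_reward expectation_rew by (metis add.commute diff_add_cancel)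
  qed
  have "(\<Sum>t=1..T. \<integral>\<omega>. reward inst \<sigma> t \<omega> \<partial>outcomes (1/2) inst) \<le> real T * (?m1 - (?m1 - ?m0) / 4)"
    using sum_bounded_above[of "{1..T}", OF step] by simp
  moreover have "(\<lambda>k. mean (law inst k)) ` arms inst = {?m0, ?m1}"
    by (auto simp: arms_inst lessThan_Suc numeral_2_eq_2)
  ultimately show ?thesis
    using \<mu> by (simp add: pseudo_regret_def algebra_simps max_def)
qed

end

theorem theorem13:
  fixes f0 f1 :: "real \<Rightarrow> real" and \<mu> :: real and T :: nat
  assumes "reward_density f0" and "reward_density f1"
    and "(\<integral>x. \<bar>f1 x - f0 x\<bar> \<partial>lborel) > 0"
    and "\<mu> = (\<integral>x. x * f1 x \<partial>lborel) - (\<integral>x. x * f0 x \<partial>lborel)"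
    and "\<mu> > 0"
    and "real T \<le> 1 / (2 * (\<integral>x. \<bar>f0 x - f1 x\<bar> \<partial>lborel)) + 1"
  shows "R_L (1/2) (density_instances 2 (1/2) f0 f1) T \<ge> ereal (real T * \<mu> / 4)"
  unfolding R_L_def
proof (rule INF_greatest)
  fix \<sigma> assume \<sigma>: "\<sigma> \<in> strategies"
  define f where "f = (\<lambda>s. if s then f1 else f0)"
  define D where "D = (\<lambda>s. density lborel (\<lambda>x. ennreal (f s x)))"
  define \<delta> where "\<delta> = (\<integral>x. \<bar>f1 x - f0 x\<bar> \<partial>lborel)"
  have f: "f s \<in> borel_measurable borel" "integrable lborel (f s)" "0 \<le> f s x"
      "(\<integral>x. f s x \<partial>lborel) = 1" "integrable lborel (\<lambda>x. x * f s x)" for s x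
    using assms(1,2) by (auto simp: f_def reward_density_def)
  note [measurable] = f(1)
  have mean: "mean (D s) = (\<integral>x. x * f s x \<partial>lborel)" for s
    unfolding mean_def D_def using f(3) by (subst integral_density) (auto simp: mult.commute)
  interpret two_arms D \<sigma>
  proof (rule two_arms.intro)
    show "prob_space (D s)" for s
      using f(2-4)[of s] nn_integral_eq_integral[of lborel "f s"]
      by (intro prob_spaceI) (simp add: D_def emeasure_density)
    show "integrable (D s) (\<lambda>x. x)" for s
      unfolding D_def using f(3,5)[of s] by (subst integrable_density) (auto simp: mult.commute)
  qed (simp_all add: D_def \<sigma>)
  have \<mu>: "mean (D True) - mean (D False) = \<mu>"
    using assms(4) by (simp add: mean f_def)
  have "inst \<in> density_instances 2 (1/2) f0 f1"
    using \<mu> assms(5) prob_space_D integrable_D sets_D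
    by (auto simp: density_instances_def valid_mab_def two_types_def inferior_inst arms_inst)
      (auto simp: D_def f_def)
  moreover have "real T * \<mu> / 4 \<le> pseudo_regret (1/2) inst \<sigma> T"
    unfolding \<mu>[symmetric]
  proof (rule pseudo_regret_ge)
    show "\<bar>(\<integral>x. \<psi> x \<partial>D True) - (\<integral>x. \<psi> x \<partial>D False)\<bar> \<le> \<delta>"
      if "\<psi> \<in> borel_measurable borel" "\<And>x. 0 \<le> \<psi> x \<and> \<psi> x \<le> 1" for \<psi>
      using integral_density_diff_le[of "f True" "f False" \<psi>] that f
      by (simp add: D_def \<delta>_def f_def abs_le_iff) (smt (verit))
    have "\<delta> > 0" "real T - 1 \<le> 1 / (2 * \<delta>)"
      using assms(3,6) by (auto simp: \<delta>_def abs_minus_commute)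
    then show "(real T - 1) * \<delta> \<le> 1/2"
      by (simp add: field_simps)
  qed (use \<mu> assms(5) in simp)
  ultimately show "ereal (real T * \<mu> / 4)
      \<le> (SUP M\<in>density_instances 2 (1/2) f0 f1. ereal (pseudo_regret (1/2) M \<sigma> T))"
    by (intro SUP_upper2) auto
qed

end
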